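(* Let $\ell\ge3$, let $\lambda$ be an $(\ell,0)$-JM partition, $0\le i<\ell$, and put $\widehat\varphi=\widehat\varphi_i(\lambda)$, $\widehat\varepsilon=\widehat\varepsilon_i(\lambda)$. Then (1) $\widehat f_i^{k}\lambda$ is not an $(\ell,0)$-JM partition for $0<k<\widehat\varphi-1$; (2) $\widehat e_i^{k}\lambda$ is not an $(\ell,0)$-JM partition for $1<k<\widehat\varepsilon$.
   Context: Young diagrams in English notation; $(a,b)$ is the box in row $a$, column $b$, residue $b-a\bmod\ell$. Hook length $h^\lambda_{(a,b)}$: number of boxes of $\lambda$ in row $a$ weakly right of $(a,b)$ plus those in column $b$ strictly below. $\lambda$ is an $(\ell,0)$-JM partition if there are no boxes $(a,b),(a,y),(x,b)$ of $\lambda$ with $\ell\mid h^\lambda_{(a,b)}$, $\ell\nmid h^\lambda_{(a,y)}$, $\ell\nmid h^\lambda_{(x,b)}$. Removable (resp. addable) $i$-box: a box in $\lambda$ (resp. position not in $\lambda$) of residue $i$ whose removal (resp. addition) yields a partition. The ladder of $(a,b)$ is the set of positions $(c,d)$, $c,d\ge1$, with $c+(\ell-1)d=a+(\ell-1)b$; ladders are ordered left to right by increasing $c+(\ell-1)d$, within a ladder top to bottom by increasing row index. Ladder crystal: the ladder $i$-signature of $\lambda$ writes $+$ for each addable $i$-box and $-$ for each removable $i$-box, reading ladders left to right and each ladder top to bottom; repeatedly deleting adjacent "$-+$" gives $+\cdots+-\cdots-$. Remaining $-$'s are ladder normal $i$-boxes (leftmost: ladder good), remaining $+$'s ladder conormal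 (rightmost: ladder cogood). $\widehat f_i\lambda$ adds the ladder cogood $i$-box, $\widehat e_i\lambda$ removes the ladder good $i$-box ($0$ if none); $\widehat\varphi_i(\lambda)$, $\widehat\varepsilon_i(\lambda)$ are the numbers of ladder conormal, ladder normal $i$-boxes. *)

theory Defs
  imports Main "HOL-Library.Product_Lexorder"
begin

text \<open>
  Boxes are pairs (row, column), both counted from 1, in English notation. A partition is
  identified with the set of boxes of its Young diagram.
\<close>

type_synonym box = "nat \<times> nat"

definition is_partition :: "box set \<Rightarrow> bool" where
  "is_partition lam \<longleftrightarrow> finite lam \<and>
     (\<forall>(a, b) \<in> lam. 1 \<le> a \<and> 1 \<le> b \<and>
        (\<forall>c d. 1 \<le> c \<and> c \<le> a \<and> 1 \<le> d \<and> d \<le> b \<longrightarrow> (c, d) \<in> lam))"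

fun residue :: "nat \<Rightarrow> box \<Rightarrow> int" where
  "residue l (a, b) = (int b - int a) mod int l"

fun hook :: "box set \<Rightarrow> box \<Rightarrow> nat" where
  "hook lam (a, b) = card {y. b \<le> y \<and> (a, y) \<in> lam} + card {x. a < x \<and> (x, b) \<in> lam}"

text \<open>
  The hook condition only; that the set of boxes is a partition is a separate hypothesis, so that
  the negation of this predicate always refers to an actual violation of the hook condition.
\<close>

definition JM :: "nat \<Rightarrow> box set \<Rightarrow> bool" where
  "JM l lam \<longleftrightarrow> \<not> (\<exists>a b x y. (a, b) \<in> lam \<and> (a, y) \<in> lam \<and> (x, b) \<in> lam \<and>
     l dvd hook lam (a, b) \<and> \<not> l dvd hook lam (a, y) \<and> \<not> l dvd hook lam (x, b))"

definition removable :: "nat \<Rightarrow> nat \<Rightarrow> box set \<Rightarrow> box set" where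
  "removable l i lam = {p. p \<in> lam \<and> residue l p = int i \<and> is_partition (lam - {p})}"

definition addable :: "nat \<Rightarrow> nat \<Rightarrow> box set \<Rightarrow> box set" where
  "addable l i lam = {p. p \<notin> lam \<and> residue l p = int i \<and> is_partition (insert p lam)}"

text \<open>
  Compared lexicographically: the first component numbers the ladders from left to right, the
  second orders the positions of one ladder from top to bottom.
\<close>

fun ladder_key :: "nat \<Rightarrow> box \<Rightarrow> nat \<times> nat" where
  "ladder_key l (c, d) = (c + (l - 1) * d, c)"

lemma inj_ladder_key: "2 \<le> l \<Longrightarrow> inj (ladder_key l)"
  by (auto simp: inj_def)

datatype sign = Plus | Minus

text \<open>Each sign of a signature is paired with the box it comes from.\<close>

definition ladder_signature :: "nat \<Rightarrow> nat \<Rightarrow> box set \<Rightarrow> (sign \<times> box) list" where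
  "ladder_signature l i lam =
     map (\<lambda>p. (if p \<in> addable l i lam then Plus else Minus, p))
       (sorted_key_list_of_set (ladder_key l) (addable l i lam \<union> removable l i lam))"

inductive delete_pair :: "(sign \<times> 'a) list \<Rightarrow> (sign \<times> 'a) list \<Rightarrow> bool" where
  "delete_pair (u @ [(Minus, p), (Plus, q)] @ v) (u @ v)"

fun push :: "sign \<times> 'a \<Rightarrow> (sign \<times> 'a) list \<Rightarrow> (sign \<times> 'a) list" where
  "push (Minus, p) ((Plus, q) # w) = w"
| "push s w = s # w"

definition reduce :: "(sign \<times> 'a) list \<Rightarrow> (sign \<times> 'a) list" where
  "reduce w = foldr push w []"

text \<open>
  Deleting adjacent minus-plus pairs until none is left always ends in the word computed by
  \<open>reduce\<close>, whatever pairs are chosen.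
\<close>

lemma push_Plus: "push (Plus, q) w = (Plus, q) # w"
  by (cases w) auto

lemma delete_pair_Cons: "delete_pair v w \<Longrightarrow> delete_pair (s # v) (s # w)"
  by (metis append_Cons delete_pair.simps)

lemma delete_pairs_Cons: "delete_pair\<^sup>*\<^sup>* v w \<Longrightarrow> delete_pair\<^sup>*\<^sup>* (s # v) (s # w)"
  by (induction rule: rtranclp_induct)
     (auto intro: rtranclp.rtrancl_into_rtrancl delete_pair_Cons)

lemma reduce_reachable: "delete_pair\<^sup>*\<^sup>* w (reduce w)"
proof (induction w)
  case (Cons s w)
  have "delete_pair\<^sup>*\<^sup>* (s # reduce w) (push s (reduce w))"
  proof (cases "(s, reduce w)" rule: push.cases)
    case (1 p q u)
    then show ?thesis
      using delete_pair.intros[of "[]" p q u] by auto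
  qed auto
  with delete_pairs_Cons[OF Cons.IH, of s] show ?case
    by (simp add: reduce_def)
qed (simp add: reduce_def)

lemma reduce_delete_pair: "delete_pair v w \<Longrightarrow> reduce v = reduce w"
  by (induction rule: delete_pair.induct) (simp add: reduce_def push_Plus)

lemma reduce_irreducible: "\<nexists>u. delete_pair w u \<Longrightarrow> reduce w = w"
  using reduce_reachable[of w] by (metis converse_rtranclpE)

lemma reduce_unique:
  assumes "delete_pair\<^sup>*\<^sup>* w v" "\<nexists>u. delete_pair v u"
  shows "v = reduce w"
proof -
  from assms(1) have "reduce w = reduce v"
    by (induction rule: rtranclp_induct) (auto dest: reduce_delete_pair)
  with reduce_irreducible[OF assms(2)] show ?thesis by simp
qed

definition ladder_conormal :: "nat \<Rightarrow> nat \<Rightarrow> box set \<Rightarrow> box list" where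
  "ladder_conormal l i lam =
     map snd (filter (\<lambda>s. fst s = Plus) (reduce (ladder_signature l i lam)))"

definition ladder_normal :: "nat \<Rightarrow> nat \<Rightarrow> box set \<Rightarrow> box list" where
  "ladder_normal l i lam =
     map snd (filter (\<lambda>s. fst s = Minus) (reduce (ladder_signature l i lam)))"

definition phi_hat :: "nat \<Rightarrow> nat \<Rightarrow> box set \<Rightarrow> nat" where
  "phi_hat l i lam = length (ladder_conormal l i lam)"

definition eps_hat :: "nat \<Rightarrow> nat \<Rightarrow> box set \<Rightarrow> nat" where
  "eps_hat l i lam = length (ladder_normal l i lam)"

text \<open>The value 0 of the crystal operators is rendered as \<open>None\<close>.\<close>

definition f_hat :: "nat \<Rightarrow> nat \<Rightarrow> box set \<Rightarrow> box set option" where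
  "f_hat l i lam =
     (let ps = ladder_conormal l i lam in
      if ps = [] then None else Some (insert (last ps) lam))"

definition e_hat :: "nat \<Rightarrow> nat \<Rightarrow> box set \<Rightarrow> box set option" where
  "e_hat l i lam =
     (let ps = ladder_normal l i lam in
      if ps = [] then None else Some (lam - {hd ps}))"

definition iterate :: "('a \<Rightarrow> 'a option) \<Rightarrow> nat \<Rightarrow> 'a \<Rightarrow> 'a option" where
  "iterate g k x = ((\<lambda>z. Option.bind z g) ^^ k) (Some x)"

end

theory Submission
  imports Defs
begin

text \<open>
  A partition with two addable and one removable \<open>i\<close>-box violates the hook condition. The hook at
  the corner spanned by an addable and a removable \<open>i\<close>-box is divisible by \<open>l\<close>, the hook at the
  corner spanned by two addable \<open>i\<close>-boxes is -1 modulo \<open>l\<close>, and the hook at a removable box is 1.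
  Each application of \<open>f_hat\<close> turns one addable box into a removable one and lowers \<open>phi_hat\<close>
  by 1, so for \<open>0 < k < phi_hat - 1\<close> two addable boxes and a removable one are present;
  \<open>e_hat\<close> is dual.
\<close>

section \<open>Corner criteria for addable and removable boxes\<close>

section \<open>Partitions\<close>

lemma partition_down:
  "is_partition lam \<Longrightarrow> (a, b) \<in> lam \<Longrightarrow> 1 \<le> c \<Longrightarrow> c \<le> a \<Longrightarrow> 1 \<le> d \<Longrightarrow> d \<le> b \<Longrightarrow> (c, d) \<in> lam"
  unfolding is_partition_def by blast

lemma partition_pos: "is_partition lam \<Longrightarrow> (a, b) \<in> lam \<Longrightarrow> 1 \<le> a \<and> 1 \<le> b"
  unfolding is_partition_def by blast

lemma partition_finite: "is_partition lam \<Longrightarrow> finite lam"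
  unfolding is_partition_def by blast

text \<open>Deleting a box spoils the closure only if another box lies weakly below and weakly right
  of it. By closure of \<open>lam\<close>, the neighbour below or the neighbour to the right is then
  present as well.\<close>

lemma removable_iff:
  assumes "is_partition lam"
  shows "(a, b) \<in> removable l i lam \<longleftrightarrow>
    (a, b) \<in> lam \<and> residue l (a, b) = int i \<and> (Suc a, b) \<notin> lam \<and> (a, Suc b) \<notin> lam"
    (is "?L \<longleftrightarrow> ?R")
proof
  assume L: ?L
  then have part: "is_partition (lam - {(a, b)})" and ab: "(a, b) \<in> lam"
    by (auto simp: removable_def)
  have pos: "1 \<le> a" "1 \<le> b"
    using partition_pos[OF assms ab] by auto
  have "(Suc a, b) \<notin> lam"
    using partition_down[OF part, of "Suc a" b a b] pos by auto
  moreover have "(a, Suc b) \<notin> lam"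
    using partition_down[OF part, of a "Suc b" a b] pos by auto
  ultimately show ?R
    using L by (auto simp: removable_def)
next
  assume R: ?R
  have pos: "1 \<le> a" "1 \<le> b"
    using partition_pos[OF assms] R by auto
  have "(c, d) \<in> lam - {(a, b)}"
    if "(x, y) \<in> lam - {(a, b)}" "1 \<le> c" "c \<le> x" "1 \<le> d" "d \<le> y" for x y c d
  proof -
    have "(c, d) \<noteq> (a, b)"
    proof
      assume eq: "(c, d) = (a, b)"
      with that have "Suc a \<le> x \<or> Suc b \<le> y"
        by auto
      then show False
        using partition_down[OF assms, of x y "Suc a" b]
          partition_down[OF assms, of x y a "Suc b"] that eq R pos by auto
    qed
    then show ?thesis
      using partition_down[OF assms, of x y c d] that by auto
  qed
  then have "is_partition (lam - {(a, b)})"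
    using assms partition_pos[OF assms] partition_finite[OF assms]
    unfolding is_partition_def by blast
  then show ?L
    using R by (auto simp: removable_def)
qed

text \<open>Everything weakly above and left of \<open>(a, b)\<close> other than itself lies weakly
  above and left of \<open>(a - 1, b)\<close> or of \<open>(a, b - 1)\<close>. The cases
  \<open>a = 1\<close> and \<open>b = 1\<close> stand for the missing row and column 0.\<close>

lemma addable_iff:
  assumes "is_partition lam"
  shows "(a, b) \<in> addable l i lam \<longleftrightarrow>
    (a, b) \<notin> lam \<and> residue l (a, b) = int i \<and> 1 \<le> a \<and> 1 \<le> b \<and>
    (a = 1 \<or> (a - 1, b) \<in> lam) \<and> (b = 1 \<or> (a, b - 1) \<in> lam)" (is "?L \<longleftrightarrow> ?R")
proof
  assume L: ?L
  then have part: "is_partition (insert (a, b) lam)"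
    by (auto simp: addable_def)
  have pos: "1 \<le> a" "1 \<le> b"
    using partition_pos[OF part, of a b] by auto
  have "1 \<le> a - 1 \<Longrightarrow> (a - 1, b) \<in> lam"
    using partition_down[OF part, of a b "a - 1" b] pos by auto
  then have "a = 1 \<or> (a - 1, b) \<in> lam"
    using pos by linarith
  moreover have "1 \<le> b - 1 \<Longrightarrow> (a, b - 1) \<in> lam"
    using partition_down[OF part, of a b a "b - 1"] pos by auto
  then have "b = 1 \<or> (a, b - 1) \<in> lam"
    using pos by linarith
  ultimately show ?R
    using L pos by (auto simp: addable_def)
next
  assume R: ?R
  have new: "(c, d) \<in> insert (a, b) lam" if "1 \<le> c" "c \<le> a" "1 \<le> d" "d \<le> b" for c d
  proof (cases "c = a \<and> d = b")
    case False
    then have "c \<le> a - 1 \<or> d \<le> b - 1"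
      using that by linarith
    then show ?thesis
      using partition_down[OF assms, of "a - 1" b c d]
        partition_down[OF assms, of a "b - 1" c d] that R by auto
  qed simp
  have "1 \<le> x \<and> 1 \<le> y \<and>
      (\<forall>c d. 1 \<le> c \<and> c \<le> x \<and> 1 \<le> d \<and> d \<le> y \<longrightarrow> (c, d) \<in> insert (a, b) lam)"
    if "(x, y) \<in> insert (a, b) lam" for x y
  proof (cases "(x, y) = (a, b)")
    case True
    then show ?thesis
      using new R by simp
  next
    case False
    then have "(x, y) \<in> lam"
      using that by auto
    then show ?thesis
      using partition_pos[OF assms] partition_down[OF assms] by blast
  qed
  then have "is_partition (insert (a, b) lam)"
    using partition_finite[OF assms]
    unfolding is_partition_def Ball_def split_paired_All case_prod_conv finite_insert by blast
  then show ?L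
    using R by (auto simp: addable_def)
qed

lemma finite_removable: "is_partition lam \<Longrightarrow> finite (removable l i lam)"
  by (rule finite_subset[OF _ partition_finite]) (auto simp: removable_def)

lemma finite_addable:
  assumes "is_partition lam"
  shows "finite (addable l i lam)"
proof (rule finite_subset)
  show "addable l i lam \<subseteq>
    insert (1, 1) ((\<lambda>(a, b). (Suc a, b)) ` lam \<union> (\<lambda>(a, b). (a, Suc b)) ` lam)"
  proof
    fix p assume "p \<in> addable l i lam"
    moreover obtain a b where "p = (a, b)"
      by (cases p)
    ultimately show "p \<in> insert (1, 1) ((\<lambda>(a, b). (Suc a, b)) ` lam \<union> (\<lambda>(a, b). (a, Suc b)) ` lam)"
      using addable_iff[OF assms, of a b l i] by (force simp: image_iff)
  qed
qed (simp add: partition_finite[OF assms])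

lemma addable_Int_removable: "addable l i lam \<inter> removable l i lam = {}"
  by (auto simp: addable_def removable_def)

section \<open>Effect of adding or removing an \<open>i\<close>-box on the other
  \<open>i\<close>-boxes\<close>

section \<open>Moving a box\<close>

lemma residue_neighbour:
  assumes "2 \<le> l"
  shows "residue l (Suc a, b) \<noteq> residue l (a, b)" and "residue l (a, Suc b) \<noteq> residue l (a, b)"
proof -
  have "\<not> int l dvd 1"
    using assms by auto
  then have "\<not> int l dvd (int b - int (Suc a)) - (int b - int a)"
    and "\<not> int l dvd (int (Suc b) - int a) - (int b - int a)"
    by simp_all
  then show "residue l (Suc a, b) \<noteq> residue l (a, b)" and "residue l (a, Suc b) \<noteq> residue l (a, b)"
    unfolding residue.simps mod_eq_dvd_iff by blast+
qed

text \<open>The criteria \<open>addable_iff\<close> and \<open>removable_iff\<close> inspect only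
  the neighbours of a position, and by \<open>residue_neighbour\<close> no neighbour of an
  \<open>i\<close>-position has residue \<open>i\<close>. So other \<open>i\<close>-positions do not
  notice \<open>p\<close>, and \<open>p\<close> itself merely changes from addable to
  removable.\<close>

lemma
  assumes l: "2 \<le> l" and part: "is_partition lam" and p: "p \<in> addable l i lam"
  shows addable_insert: "addable l i (insert p lam) = addable l i lam - {p}"
    and removable_insert: "removable l i (insert p lam) = insert p (removable l i lam)"
proof -
  obtain a b where ab: "p = (a, b)"
    by (cases p)
  have part': "is_partition (insert p lam)"
    using p by (auto simp: addable_def)
  have R: "(a, b) \<notin> lam" "residue l (a, b) = int i" "1 \<le> a" "1 \<le> b"
    using p addable_iff[OF part, of a b l i] ab by auto
  have above: "(Suc a, b) \<notin> lam" "(a, Suc b) \<notin> lam"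
    using partition_down[OF part, of "Suc a" b a b] partition_down[OF part, of a "Suc b" a b] R
    by auto
  have resp: "residue l p = int i"
    using R ab by simp
  \<comment> \<open>These are the four neighbour tests of the two criteria. The guards exclude index
    0, where truncated subtraction would return \<open>(c, d)\<close> itself.\<close>
  have nbr: "p \<noteq> (Suc c, d)" "p \<noteq> (c, Suc d)" "1 \<le> c \<Longrightarrow> p \<noteq> (c - 1, d)" "1 \<le> d \<Longrightarrow> p \<noteq> (c, d - 1)"
    if res: "residue l (c, d) = int i" for c d
  proof -
    show "p \<noteq> (Suc c, d)" "p \<noteq> (c, Suc d)"
      using residue_neighbour[OF l, of c d] resp unfolding res by metis+
    show "p \<noteq> (c - 1, d)" if "1 \<le> c"
    proof -
      have "Suc (c - 1) = c"
        using that by simp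
      then show ?thesis
        using residue_neighbour(1)[OF l, of "c - 1" d] resp res by metis
    qed
    show "p \<noteq> (c, d - 1)" if "1 \<le> d"
    proof -
      have "Suc (d - 1) = d"
        using that by simp
      then show ?thesis
        using residue_neighbour(2)[OF l, of c "d - 1"] resp res by metis
    qed
  qed
  show "addable l i (insert p lam) = addable l i lam - {p}"
  proof (rule set_eqI)
    fix q :: box
    obtain c d where q: "q = (c, d)"
      by (cases q)
    show "q \<in> addable l i (insert p lam) \<longleftrightarrow> q \<in> addable l i lam - {p}"
      using nbr[of c d]
      unfolding q addable_iff[OF part] addable_iff[OF part'] insert_iff Diff_iff singleton_iff
      by blast
  qed
  show "removable l i (insert p lam) = insert p (removable l i lam)"
  proof (rule set_eqI)
    fix q :: box
    obtain c d where q: "q = (c, d)"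
      by (cases q)
    have "(Suc c, d) \<notin> lam \<and> (c, Suc d) \<notin> lam \<and> residue l (c, d) = int i" if "(c, d) = p"
      using that above R ab by simp
    then show "q \<in> removable l i (insert p lam) \<longleftrightarrow> q \<in> insert p (removable l i lam)"
      using nbr[of c d]
      unfolding q removable_iff[OF part] removable_iff[OF part'] insert_iff
      by blast
  qed
qed

text \<open>This is the preceding lemma read backwards: \<open>p\<close> is addable to
  \<open>lam - {p}\<close>, and inserting it gives \<open>lam\<close> again.\<close>

lemma
  assumes l: "2 \<le> l" and part: "is_partition lam" and p: "p \<in> removable l i lam"
  shows addable_remove: "addable l i (lam - {p}) = insert p (addable l i lam)"
    and removable_remove: "removable l i (lam - {p}) = removable l i lam - {p}"
proof -
  have part': "is_partition (lam - {p})" and "p \<in> lam"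
    using p by (auto simp: removable_def)
  have ins: "insert p (lam - {p}) = lam"
    using \<open>p \<in> lam\<close> by auto
  have p': "p \<in> addable l i (lam - {p})"
    using p part ins by (auto simp: addable_def removable_def)
  have "p \<notin> removable l i (lam - {p})"
    by (simp add: removable_def)
  then show "addable l i (lam - {p}) = insert p (addable l i lam)"
    and "removable l i (lam - {p}) = removable l i lam - {p}"
    using addable_insert[OF l part' p'] removable_insert[OF l part' p'] p' unfolding ins by auto
qed

section \<open>Hook lengths as differences of contents, and the resulting violation\<close>

section \<open>The hook condition\<close>

text \<open>Row \<open>a\<close> ends in column \<open>y\<close> and column \<open>b\<close> ends in
  row \<open>x\<close>. Stating the length in \<open>int\<close> lets it be rewritten as a
  difference of contents (column minus row), which residues control modulo \<open>l\<close>.\<close>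

lemma hook_eq:
  assumes part: "is_partition lam"
    and row: "(a, y) \<in> lam" "(a, Suc y) \<notin> lam" and col: "(x, b) \<in> lam" "(Suc x, b) \<notin> lam"
    and le: "a \<le> x" "b \<le> y"
  shows "int (hook lam (a, b)) = (int y - int b + 1) + (int x - int a)"
proof -
  have pos: "1 \<le> a" "1 \<le> b"
    using partition_pos[OF part] row col by auto
  have "\<not> Suc y \<le> z" if "(a, z) \<in> lam" for z
    using partition_down[OF part that, of a "Suc y"] row pos by auto
  then have "{z. b \<le> z \<and> (a, z) \<in> lam} = {b..y}"
    using partition_down[OF part row(1), of a] pos by (auto simp: not_less_eq_eq)
  moreover have "\<not> Suc x \<le> z" if "(z, b) \<in> lam" for z
    using partition_down[OF part that, of "Suc x" b] col pos by auto
  then have "{z. a < z \<and> (z, b) \<in> lam} = {a<..x}"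
    using partition_down[OF part col(1), of _ b] pos by (auto simp: not_less_eq_eq)
  ultimately show ?thesis
    using le by simp
qed

lemma not_JM_ordered:
  assumes l: "2 \<le> l" and part: "is_partition lam"
    and q1: "(r1, c1) \<in> addable l i lam" and q2: "(r2, c2) \<in> addable l i lam" and lt: "r1 < r2"
    and p: "(a, y) \<in> removable l i lam"
  shows "\<not> JM l lam"
proof -
  have Q1: "(r1, c1) \<notin> lam" "1 \<le> r1" "1 \<le> c1" "c1 = 1 \<or> (r1, c1 - 1) \<in> lam"
    using q1 addable_iff[OF part, of r1 c1 l i] by auto
  have Q2: "(r2, c2) \<notin> lam" "1 \<le> r2" "1 \<le> c2" "(r2 - 1, c2) \<in> lam"
    using q2 addable_iff[OF part, of r2 c2 l i] lt Q1(2) by auto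
  have P: "(a, y) \<in> lam" "(Suc a, y) \<notin> lam" "(a, Suc y) \<notin> lam"
    using p removable_iff[OF part, of a y l i] by auto
  have Ppos: "1 \<le> a" "1 \<le> y"
    using partition_pos[OF part P(1)] by auto
  have "r1 \<le> r2 - 1"
    using lt by simp
  \<comment> \<open>Otherwise \<open>(r1, c1)\<close> would lie weakly above and left of the box
    \<open>(r2 - 1, c2)\<close> and belong to \<open>lam\<close>.\<close>
  then have c: "c2 < c1"
    using partition_down[OF part Q2(4), of r1 c1] Q1 by (meson not_le_imp_less)
  then have Q1': "(r1, c1 - 1) \<in> lam"
    using Q1 Q2 by auto
  have "residue l (r1, c1) = int i" "residue l (r2, c2) = int i" "residue l (a, y) = int i"
    using q1 q2 p by (auto simp: addable_def removable_def)
  then have dvd_qq: "int l dvd (int c1 - int r1) - (int c2 - int r2)"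
    and dvd_pq: "int l dvd (int y - int a) - (int c2 - int r2)"
    and dvd_qp: "int l dvd (int c1 - int r1) - (int y - int a)"
    by (simp_all add: mod_eq_dvd_iff[symmetric])
  have box: "(r1, c2) \<in> lam"
    using partition_down[OF part Q1', of r1 c2] Q1(2) Q2(3) c by simp
  \<comment> \<open>Row \<open>r1\<close> ends at \<open>c1 - 1\<close> and column \<open>c2\<close>
    at \<open>r2 - 1\<close>, just before the two addable positions; these two shifts and the corner
    box together give the final -1.\<close>
  have "int (hook lam (r1, c2)) = ((int c1 - int r1) - (int c2 - int r2)) - 1"
    using hook_eq[OF part Q1' _ Q2(4)] Q1 Q2 c lt by (simp add: of_nat_diff)
  then have hook_qq: "\<not> l dvd hook lam (r1, c2)"
    using dvd_qq l dvd_diff_right_iff[OF dvd_qq, of 1] by (auto simp flip: int_dvd_int_iff)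
  have "int (hook lam (a, y)) = 1"
    using hook_eq[OF part P(1) P(3) P(1) P(2)] by simp
  then have "hook lam (a, y) = 1"
    by linarith
  then have hook_p: "\<not> l dvd hook lam (a, y)"
    using l by (simp del: hook.simps)
  show ?thesis
  proof (cases "a < r2")
    \<comment> \<open>The removable box lies above the lower addable position. The violation is at
      \<open>(a, c2)\<close>, with \<open>(a, y)\<close> in its row and \<open>(r1, c2)\<close> in
      its column.\<close>
    case True
    have "(a, c2) \<in> lam"
      using partition_down[OF part Q2(4), of a c2] True Ppos Q2(3) by simp
    moreover from this have "\<not> Suc y \<le> c2"
      using partition_down[OF part, of a c2 a "Suc y"] P(3) Ppos by auto
    then have "c2 \<le> y"
      by simp
    then have "int (hook lam (a, c2)) = (int y - int a) - (int c2 - int r2)"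
      using hook_eq[OF part P(1) P(3) Q2(4)] Q2 True by (simp add: of_nat_diff)
    then have "l dvd hook lam (a, c2)"
      using dvd_pq by (metis int_dvd_int_iff)
    ultimately show ?thesis
      using P(1) box hook_p hook_qq unfolding JM_def by blast
  next
    \<comment> \<open>Now the removable box lies below row \<open>r1\<close>. The violation is at
      \<open>(r1, y)\<close>, and the witnesses exchange roles: \<open>(r1, c2)\<close> is in its
      row, \<open>(a, y)\<close> in its column.\<close>
    case False
    then have "r1 \<le> a"
      using lt by simp
    have "y < c1"
      using partition_down[OF part P(1), of r1 c1] Q1 \<open>r1 \<le> a\<close> by (meson not_le_imp_less)
    have "(r1, y) \<in> lam"
      using partition_down[OF part P(1), of r1 y] Q1(2) Ppos \<open>r1 \<le> a\<close> by simp
    moreover have "int (hook lam (r1, y)) = (int c1 - int r1) - (int y - int a)"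
      using hook_eq[OF part Q1' _ P(1) P(2)] Q1 \<open>y < c1\<close> \<open>r1 \<le> a\<close> by (simp add: of_nat_diff)
    then have "l dvd hook lam (r1, y)"
      using dvd_qp by (metis int_dvd_int_iff)
    ultimately show ?thesis
      using P(1) box hook_p hook_qq unfolding JM_def by blast
  qed
qed

lemma not_JM:
  assumes l: "2 \<le> l" and part: "is_partition lam"
    and two: "2 \<le> card (addable l i lam)" and one: "1 \<le> card (removable l i lam)"
  shows "\<not> JM l lam"
proof -
  obtain q1 q2 where q: "q1 \<in> addable l i lam" "q2 \<in> addable l i lam" "q1 \<noteq> q2"
    using two card_le_Suc0_iff_eq[OF finite_addable[OF part, of l i]] by auto
  obtain p where p: "p \<in> removable l i lam"
    using one by (cases "removable l i lam = {}") auto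
  obtain r1 c1 r2 c2 a y where eqs: "q1 = (r1, c1)" "q2 = (r2, c2)" "p = (a, y)"
    by (metis surj_pair)
  \<comment> \<open>A row has at most one addable position, the one just past its end, so the two
    can be ordered by row.\<close>
  have "r1 \<noteq> r2"
  proof
    assume r: "r1 = r2"
    have Q: "(r1, c1) \<notin> lam" "1 \<le> r1" "1 \<le> c1" "c1 = 1 \<or> (r1, c1 - 1) \<in> lam"
      "(r1, c2) \<notin> lam" "1 \<le> c2" "c2 = 1 \<or> (r1, c2 - 1) \<in> lam"
      using q addable_iff[OF part, of r1 c1 l i] addable_iff[OF part, of r1 c2 l i] r eqs by auto
    have "c1 < c2 \<or> c2 < c1"
      using q(3) r eqs by auto
    then have "c1 \<le> c2 - 1 \<and> c2 \<noteq> 1 \<or> c2 \<le> c1 - 1 \<and> c1 \<noteq> 1"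
      using Q by linarith
    then show False
      using partition_down[OF part, of r1 "c2 - 1" r1 c1]
        partition_down[OF part, of r1 "c1 - 1" r1 c2] Q by blast
  qed
  then show ?thesis
    using not_JM_ordered[OF l part, of r1 c1 i r2 c2 a y]
      not_JM_ordered[OF l part, of r2 c2 i r1 c1 a y] q p eqs
    by (metis linorder_neqE_nat)
qed

section \<open>Reduced words and the change of a single sign\<close>

section \<open>Signatures\<close>

text \<open>The list is kept apart from the set \<open>A\<close> of plus positions, because a
  crystal operator leaves the list alone and changes \<open>A\<close> by one element.\<close>

definition signature :: "'a set \<Rightarrow> 'a list \<Rightarrow> (sign \<times> 'a) list" where
  "signature A = map (\<lambda>p. (if p \<in> A then Plus else Minus, p))"

definition pluses :: "(sign \<times> 'a) list \<Rightarrow> 'a list" where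
  "pluses w = map snd (filter (\<lambda>s. fst s = Plus) (reduce w))"

definition minuses :: "(sign \<times> 'a) list \<Rightarrow> 'a list" where
  "minuses w = map snd (filter (\<lambda>s. fst s = Minus) (reduce w))"

lemma push_Minus:
  "push (Minus, p) (map (Pair Plus) us @ map (Pair Minus) vs) =
    (if us = [] then map (Pair Minus) (p # vs) else map (Pair Plus) (tl us) @ map (Pair Minus) vs)"
  by (cases us; cases vs) auto

lemma pluses_minuses_eqI:
  assumes "reduce w = map (Pair Plus) us @ map (Pair Minus) vs"
  shows "pluses w = us" and "minuses w = vs"
  unfolding pluses_def minuses_def assms by (simp_all add: filter_map comp_def)

text \<open>The shape "pluses, then minuses" is preserved by \<open>push\<close>: a plus joins the
  front, and a minus either cancels the first plus or, if there is none, heads the minuses.\<close>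

lemma reduce_pluses_minuses: "reduce w = map (Pair Plus) (pluses w) @ map (Pair Minus) (minuses w)"
proof (induction w)
  case Nil
  then show ?case
    by (simp add: reduce_def pluses_def minuses_def)
next
  case (Cons s w)
  have "\<exists>us vs. reduce (s # w) = map (Pair Plus) us @ map (Pair Minus) vs"
  proof (cases "fst s")
    case Plus
    then have "reduce (s # w) = map (Pair Plus) (snd s # pluses w) @ map (Pair Minus) (minuses w)"
      using Cons.IH by (cases s) (simp add: reduce_def push_Plus)
    then show ?thesis by blast
  next
    case Minus
    then have eq: "reduce (s # w) =
        push (Minus, snd s) (map (Pair Plus) (pluses w) @ map (Pair Minus) (minuses w))"
      using Cons.IH by (cases s) (simp add: reduce_def)
    show ?thesis
    proof (cases "pluses w = []")
      case True
      then have "reduce (s # w) = map (Pair Plus) [] @ map (Pair Minus) (snd s # minuses w)"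
        unfolding eq push_Minus by simp
      then show ?thesis by blast
    next
      case False
      then show ?thesis
        unfolding eq push_Minus by auto
    qed
  qed
  then obtain us vs where eq: "reduce (s # w) = map (Pair Plus) us @ map (Pair Minus) vs"
    by blast
  show ?case
    unfolding pluses_minuses_eqI[OF eq] by (rule eq)
qed

lemma pluses_minuses_Nil [simp]: "pluses [] = []" "minuses [] = []"
  by (simp_all add: pluses_def minuses_def reduce_def)

lemma pluses_minuses_Plus [simp]:
  "pluses ((Plus, p) # w) = p # pluses w" "minuses ((Plus, p) # w) = minuses w"
  by (simp_all add: pluses_def minuses_def reduce_def push_Plus)

text \<open>A minus in front cancels the leftmost surviving plus, hence \<open>tl\<close>. With the
  rules for \<open>Plus\<close>, this gives a recursion for \<open>pluses\<close> and
  \<open>minuses\<close> that no longer mentions \<open>reduce\<close>.\<close>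

lemma pluses_minuses_Minus [simp]:
  "pluses ((Minus, p) # w) = tl (pluses w)"
  "minuses ((Minus, p) # w) = (if pluses w = [] then p # minuses w else minuses w)"
proof -
  have "reduce ((Minus, p) # w) = push (Minus, p) (reduce w)"
    by (simp add: reduce_def)
  also have "\<dots> = map (Pair Plus) (tl (pluses w)) @
      map (Pair Minus) (if pluses w = [] then p # minuses w else minuses w)"
    unfolding reduce_pluses_minuses[of w] push_Minus by simp
  finally show "pluses ((Minus, p) # w) = tl (pluses w)"
    and "minuses ((Minus, p) # w) = (if pluses w = [] then p # minuses w else minuses w)"
    by (rule pluses_minuses_eqI)+
qed

lemma signature_simps:
  "signature A [] = []"
  "signature A (x # xs) = (if x \<in> A then Plus else Minus, x) # signature A xs"
  by (simp_all add: signature_def)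

lemma signature_cong: "(\<And>x. x \<in> set xs \<Longrightarrow> x \<in> A \<longleftrightarrow> x \<in> B) \<Longrightarrow> signature A xs = signature B xs"
  by (simp add: signature_def)

lemma set_pluses: "set (pluses (signature A xs)) \<subseteq> set xs \<inter> A"
proof (induction xs)
  case (Cons x xs)
  have "set (tl (pluses (signature A xs))) \<subseteq> set (pluses (signature A xs))"
    by (cases "pluses (signature A xs)") auto
  with Cons show ?case
    by (auto simp: signature_simps)
qed (simp add: signature_simps)

lemma set_minuses: "set (minuses (signature A xs)) \<subseteq> set xs - A"
  by (induction xs) (auto simp: signature_simps)

lemma distinct_pluses: "distinct xs \<Longrightarrow> distinct (pluses (signature A xs))"
proof (induction xs)
  case (Cons x xs)
  then show ?case
    using set_pluses[of A xs] by (auto simp: signature_simps distinct_tl)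
qed (simp add: signature_simps)

lemma distinct_minuses: "distinct xs \<Longrightarrow> distinct (minuses (signature A xs))"
proof (induction xs)
  case (Cons x xs)
  then show ?case
    using set_minuses[of A xs] by (auto simp: signature_simps)
qed (simp add: signature_simps)

lemma last_pluses_in: "pluses (signature A xs) \<noteq> [] \<Longrightarrow> last (pluses (signature A xs)) \<in> set xs \<inter> A"
  using subsetD[OF set_pluses[of A xs] last_in_set[of "pluses (signature A xs)"]] .

lemma hd_minuses_in: "minuses (signature A xs) \<noteq> [] \<Longrightarrow> hd (minuses (signature A xs)) \<in> set xs - A"
  using subsetD[OF set_minuses[of A xs] hd_in_set[of "minuses (signature A xs)"]] .

text \<open>A new sign in front acts on the surviving pluses by cons or \<open>tl\<close>, at the
  end opposite to \<open>last\<close>, so it commutes with \<open>butlast\<close>. Only when the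
  tail has no surviving plus is the flipped position the head itself.\<close>

lemma pluses_flip:
  assumes "distinct xs" "pluses (signature A xs) \<noteq> []"
  shows "pluses (signature (A - {last (pluses (signature A xs))}) xs) =
    butlast (pluses (signature A xs))"
  using assms
proof (induction xs)
  case Nil
  then show ?case by (simp add: signature_simps)
next
  case (Cons x xs)
  let ?c = "pluses (signature A xs)"
  show ?case
  proof (cases "?c = []")
    case True
    then have "x \<in> A"
      using Cons.prems by (auto simp: signature_simps split: if_splits)
    moreover have "signature (A - {x}) xs = signature A xs"
      using Cons.prems by (intro signature_cong) auto
    ultimately show ?thesis
      using True by (simp add: signature_simps)
  next
    case False
    then have "last ?c \<noteq> x"
      using last_pluses_in[OF False] Cons.prems by auto
    moreover have "pluses (signature (A - {last ?c}) xs) = butlast ?c"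
      using Cons.IH Cons.prems(1) False by simp
    ultimately show ?thesis
      using False Cons.prems by (cases "x \<in> A") (simp_all add: signature_simps last_tl butlast_tl)
  qed
qed

text \<open>Both claims are proved together, since whether a minus in front survives depends on the
  pluses behind it. The flipped sign becomes the last surviving plus, so it is cancelled only after
  all others, and no minus in front that was uncancelled can precede the leftmost survivor.\<close>

lemma minuses_flip:
  assumes "distinct xs" "minuses (signature A xs) \<noteq> []"
  shows "pluses (signature (insert (hd (minuses (signature A xs))) A) xs) =
      pluses (signature A xs) @ [hd (minuses (signature A xs))] \<and>
    minuses (signature (insert (hd (minuses (signature A xs))) A) xs) = tl (minuses (signature A xs))"
  using assms
proof (induction xs)
  case Nil
  then show ?case by (simp add: signature_simps)
next
  case (Cons x xs)
  let ?m = "minuses (signature A xs)"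
  show ?case
  proof (cases "x \<notin> A \<and> pluses (signature A xs) = []")
    case True
    moreover have "signature (insert x A) xs = signature A xs"
      using Cons.prems by (intro signature_cong) auto
    ultimately show ?thesis
      by (simp add: signature_simps)
  next
    case False
    then have m: "minuses (signature A (x # xs)) = ?m"
      by (auto simp: signature_simps)
    then have "?m \<noteq> []"
      using Cons.prems by simp
    then have "hd ?m \<noteq> x"
      using hd_minuses_in[of A xs] Cons.prems by auto
    moreover have "pluses (signature (insert (hd ?m) A) xs) = pluses (signature A xs) @ [hd ?m]"
      "minuses (signature (insert (hd ?m) A) xs) = tl ?m"
      using Cons.IH Cons.prems(1) \<open>?m \<noteq> []\<close> by simp_all
    ultimately show ?thesis
      using False unfolding m by (cases "x \<in> A") (simp_all add: signature_simps)
  qed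
qed

section \<open>One step of the operators on partitions\<close>

section \<open>Crystal operators\<close>

context linorder
begin

text \<open>An injective key allows the locale \<open>folding_insort_key\<close> to be interpreted
  over all of \<open>UNIV\<close>.\<close>

lemma
  assumes "inj f"
  shows set_sorted_key_list_of_set_inj: "finite A \<Longrightarrow> set (sorted_key_list_of_set f A) = A"
    and distinct_sorted_key_list_of_set_inj: "distinct (sorted_key_list_of_set f A)"
proof -
  interpret folding_insort_key "(\<le>)" "(<)" UNIV f
    using assms by unfold_locales
  show "finite A \<Longrightarrow> set (sorted_key_list_of_set f A) = A"
    by (rule set_sorted_key_list_of_set) auto
  show "distinct (sorted_key_list_of_set f A)"
    by (rule distinct_if_distinct_map, rule distinct_sorted_key_list_of_set) auto
qed

end

definition ladder_list :: "nat \<Rightarrow> nat \<Rightarrow> box set \<Rightarrow> box list" where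
  "ladder_list l i lam =
     sorted_key_list_of_set (ladder_key l) (addable l i lam \<union> removable l i lam)"

lemma
  assumes "2 \<le> l" "is_partition lam"
  shows set_ladder_list: "set (ladder_list l i lam) = addable l i lam \<union> removable l i lam"
    and distinct_ladder_list: "distinct (ladder_list l i lam)"
  unfolding ladder_list_def
  by (simp_all add: set_sorted_key_list_of_set_inj distinct_sorted_key_list_of_set_inj
      inj_ladder_key finite_addable finite_removable assms)

lemma ladder_conormal_eq:
  "ladder_conormal l i lam = pluses (signature (addable l i lam) (ladder_list l i lam))"
  by (simp add: ladder_conormal_def pluses_def ladder_signature_def signature_def ladder_list_def)

lemma ladder_normal_eq:
  "ladder_normal l i lam = minuses (signature (addable l i lam) (ladder_list l i lam))"
  by (simp add: ladder_normal_def minuses_def ladder_signature_def signature_def ladder_list_def)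

text \<open>The surviving pluses are distinct addable boxes. This bound, like its dual below, turns
  crystal data into the box counts that \<open>not_JM\<close> asks for.\<close>

lemma phi_hat_le_card:
  assumes "2 \<le> l" "is_partition lam"
  shows "phi_hat l i lam \<le> card (addable l i lam)"
proof -
  have "set (ladder_conormal l i lam) \<subseteq> addable l i lam"
    unfolding ladder_conormal_eq
    using set_pluses[of "addable l i lam" "ladder_list l i lam"] by auto
  moreover have "distinct (ladder_conormal l i lam)"
    unfolding ladder_conormal_eq by (rule distinct_pluses[OF distinct_ladder_list[OF assms]])
  ultimately show ?thesis
    using card_mono[OF finite_addable[OF assms(2)]] by (simp add: phi_hat_def distinct_card[symmetric])
qed

lemma eps_hat_le_card:
  assumes "2 \<le> l" "is_partition lam"
  shows "eps_hat l i lam \<le> card (removable l i lam)"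
proof -
  have "set (ladder_normal l i lam) \<subseteq> removable l i lam"
    unfolding ladder_normal_eq
    using set_minuses[of "addable l i lam" "ladder_list l i lam"] set_ladder_list[OF assms] by auto
  moreover have "distinct (ladder_normal l i lam)"
    unfolding ladder_normal_eq by (rule distinct_minuses[OF distinct_ladder_list[OF assms]])
  ultimately show ?thesis
    using card_mono[OF finite_removable[OF assms(2)]] by (simp add: eps_hat_def distinct_card[symmetric])
qed

text \<open>The cogood box passes from addable to removable, so the union of both sets, and with it
  the ladder order, is unchanged. Only one sign flips, which is the situation of
  \<open>pluses_flip\<close>.\<close>

lemma f_hat_step:
  assumes l: "2 \<le> l" and part: "is_partition lam" and pos: "0 < phi_hat l i lam"
  obtains mu where "f_hat l i lam = Some mu" "is_partition mu"
    "Suc (phi_hat l i mu) = phi_hat l i lam"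
    "card (removable l i mu) = Suc (card (removable l i lam))"
proof -
  define p where "p = last (ladder_conormal l i lam)"
  have ne: "ladder_conormal l i lam \<noteq> []"
    using pos by (auto simp: phi_hat_def)
  then have p: "p \<in> addable l i lam"
    using last_pluses_in unfolding p_def ladder_conormal_eq by blast
  have list: "ladder_list l i (insert p lam) = ladder_list l i lam"
    unfolding ladder_list_def addable_insert[OF l part p] removable_insert[OF l part p]
    by (rule arg_cong[where f = "sorted_key_list_of_set _"]) (use p in auto)
  have "ladder_conormal l i (insert p lam) = butlast (ladder_conormal l i lam)"
    using pluses_flip[OF distinct_ladder_list[OF l part]
        ne[unfolded ladder_conormal_eq], folded ladder_conormal_eq p_def]
    unfolding ladder_conormal_eq[of l i "insert p lam"] addable_insert[OF l part p] list .
  then have "Suc (phi_hat l i (insert p lam)) = phi_hat l i lam"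
    using ne by (simp add: phi_hat_def)
  moreover have "is_partition (insert p lam)"
    using p by (simp add: addable_def)
  moreover have "card (removable l i (insert p lam)) = Suc (card (removable l i lam))"
    using p addable_Int_removable[of l i lam] finite_removable[OF part, of l i]
    unfolding removable_insert[OF l part p] by (intro card_insert_disjoint) auto
  moreover have "f_hat l i lam = Some (insert p lam)"
    using ne by (simp add: f_hat_def p_def)
  ultimately show ?thesis
    using that by blast
qed

lemma e_hat_step:
  assumes l: "2 \<le> l" and part: "is_partition lam" and pos: "0 < eps_hat l i lam"
  obtains mu where "e_hat l i lam = Some mu" "is_partition mu"
    "Suc (eps_hat l i mu) = eps_hat l i lam"
    "card (addable l i mu) = Suc (card (addable l i lam))"
proof -
  define p where "p = hd (ladder_normal l i lam)"
  have ne: "ladder_normal l i lam \<noteq> []"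
    using pos by (auto simp: eps_hat_def)
  then have p: "p \<in> removable l i lam"
    using hd_minuses_in set_ladder_list[OF l part] unfolding p_def ladder_normal_eq by blast
  have list: "ladder_list l i (lam - {p}) = ladder_list l i lam"
    unfolding ladder_list_def addable_remove[OF l part p] removable_remove[OF l part p]
    by (rule arg_cong[where f = "sorted_key_list_of_set _"]) (use p in auto)
  have "ladder_normal l i (lam - {p}) = tl (ladder_normal l i lam)"
    using minuses_flip[OF distinct_ladder_list[OF l part]
        ne[unfolded ladder_normal_eq], folded ladder_normal_eq p_def]
    unfolding ladder_normal_eq[of l i "lam - {p}"] addable_remove[OF l part p] list by blast
  then have "Suc (eps_hat l i (lam - {p})) = eps_hat l i lam"
    using ne by (simp add: eps_hat_def)
  moreover have "is_partition (lam - {p})"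
    using p by (simp add: removable_def)
  moreover have "card (addable l i (lam - {p})) = Suc (card (addable l i lam))"
    using p addable_Int_removable[of l i lam] finite_addable[OF part, of l i]
    unfolding addable_remove[OF l part p] by (intro card_insert_disjoint) auto
  moreover have "e_hat l i lam = Some (lam - {p})"
    using ne by (simp add: e_hat_def p_def)
  ultimately show ?thesis
    using that by blast
qed

section \<open>Iterating the operators and counting boxes\<close>

lemma iterate_0: "iterate g 0 x = Some x"
  by (simp add: iterate_def)

lemma iterate_Suc: "iterate g (Suc k) x = Option.bind (iterate g k x) g"
  by (simp add: iterate_def)

text \<open>Each step creates one removable \<open>i\<close>-box, so at least \<open>k\<close> are
  present after \<open>k\<close> steps. The bound on \<open>k\<close> keeps \<open>phi_hat\<close>
  positive before every step, so \<open>None\<close> never occurs.\<close>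

lemma iterate_f_hat:
  assumes "2 \<le> l" "is_partition lam" "k \<le> phi_hat l i lam"
  shows "\<exists>mu. iterate (f_hat l i) k lam = Some mu \<and> is_partition mu \<and>
    phi_hat l i mu + k = phi_hat l i lam \<and> k \<le> card (removable l i mu)"
  using assms(3)
proof (induction k)
  case 0
  then show ?case
    using assms by (simp add: iterate_0)
next
  case (Suc k)
  then obtain mu where mu: "iterate (f_hat l i) k lam = Some mu" "is_partition mu"
    "phi_hat l i mu + k = phi_hat l i lam" "k \<le> card (removable l i mu)"
    by auto
  moreover have "0 < phi_hat l i mu"
    using mu Suc.prems by simp
  ultimately show ?case
    using assms(1) by (elim f_hat_step[rotated 2]) (auto simp: iterate_Suc)
qed

lemma iterate_e_hat:
  assumes "2 \<le> l" "is_partition lam" "k \<le> eps_hat l i lam"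
  shows "\<exists>mu. iterate (e_hat l i) k lam = Some mu \<and> is_partition mu \<and>
    eps_hat l i mu + k = eps_hat l i lam \<and> k \<le> card (addable l i mu)"
  using assms(3)
proof (induction k)
  case 0
  then show ?case
    using assms by (simp add: iterate_0)
next
  case (Suc k)
  then obtain mu where mu: "iterate (e_hat l i) k lam = Some mu" "is_partition mu"
    "eps_hat l i mu + k = eps_hat l i lam" "k \<le> card (addable l i mu)"
    by auto
  moreover have "0 < eps_hat l i mu"
    using mu Suc.prems by simp
  ultimately show ?case
    using assms(1) by (elim e_hat_step[rotated 2]) (auto simp: iterate_Suc)
qed

theorem theorem8p6:
  fixes l i :: nat and lam :: "box set"
  assumes "3 \<le> l" and "i < l"
    and "is_partition lam" and "JM l lam"
  shows "(\<forall>k. 0 < k \<and> k < phi_hat l i lam - 1 \<longrightarrow>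
            (\<exists>mu. iterate (f_hat l i) k lam = Some mu \<and> \<not> JM l mu))
       \<and> (\<forall>k. 1 < k \<and> k < eps_hat l i lam \<longrightarrow>
            (\<exists>mu. iterate (e_hat l i) k lam = Some mu \<and> \<not> JM l mu))"
proof (intro conjI allI impI; elim conjE)
  have l: "2 \<le> l"
    using assms(1) by simp
  fix k
  show "\<exists>mu. iterate (f_hat l i) k lam = Some mu \<and> \<not> JM l mu"
    if k: "0 < k" "k < phi_hat l i lam - 1"
  proof -
    obtain mu where mu: "iterate (f_hat l i) k lam = Some mu" "is_partition mu"
      "phi_hat l i mu + k = phi_hat l i lam" "k \<le> card (removable l i mu)"
      using iterate_f_hat[OF l assms(3), of k i] k by fastforce
    \<comment> \<open>Here \<open>phi_hat l i mu\<close> is at least 2, giving two addable boxes,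
      and \<open>0 < k\<close> gives a removable one. If \<open>phi_hat l i lam\<close> is 0,
      truncated subtraction leaves no such \<open>k\<close>.\<close>
    then have "\<not> JM l mu"
      using not_JM[OF l mu(2), of i] phi_hat_le_card[OF l mu(2), of i] k by linarith
    with mu(1) show ?thesis
      by blast
  qed
  show "\<exists>mu. iterate (e_hat l i) k lam = Some mu \<and> \<not> JM l mu"
    if k: "1 < k" "k < eps_hat l i lam"
  proof -
    obtain mu where mu: "iterate (e_hat l i) k lam = Some mu" "is_partition mu"
      "eps_hat l i mu + k = eps_hat l i lam" "k \<le> card (addable l i mu)"
      using iterate_e_hat[OF l assms(3), of k i] k by fastforce
    \<comment> \<open>The roles are reversed: \<open>1 < k\<close> gives two addable boxes, and
      \<open>eps_hat l i mu\<close>, at least 1, gives a removable one.\<close>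
    then have "\<not> JM l mu"
      using not_JM[OF l mu(2), of i] eps_hat_le_card[OF l mu(2), of i] k by linarith
    with mu(1) show ?thesis
      by blast
  qed
qed

end
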